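(* Let $p,q,r$ be real numbers in the open interval $(1,\infty)$ such that $\frac1p+\frac1q+\frac1r=2$. Then for any functions $g\in L_p(\mathbb{R})$, $f\in L_q(\mathbb{R})$ and $h\in L_r(\mathbb{R})$, $$\left|\int_{\mathbb{R}} \big(f\underset{H_1,F}{*} g\big)(x)\, h(x)\, dx\right|\leq \sqrt{\frac{2}{\pi}}\, \|g\|_{L_p(\mathbb{R})} \|f\|_{L_q(\mathbb{R})}\|h\|_{L_r(\mathbb{R})}.$$
   Context: The Hartley-Fourier generalized convolution of $f$ and $g$ is $$\big(f\underset{H_1,F}{*}g\big)(x):=\frac{1}{2\sqrt{2\pi}}\int_{\mathbb{R}} g(y)\,[f(x+y)+f(x-y)+i\,f(-x-y)-i\,f(-x+y)]\,dy,\quad x\in\mathbb{R}.$$ $L_p(\mathbb{R})$ denotes the usual Lebesgue space with $\|f\|_{L_p(\mathbb{R})}=\big(\int_{\mathbb{R}}|f(x)|^p dx\big)^{1/p}$. *)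

theory Defs
  imports "HOL-Analysis.Analysis"
begin

definition in_Lp :: "real \<Rightarrow> (real \<Rightarrow> complex) \<Rightarrow> bool" where
  "in_Lp p f \<longleftrightarrow>
     f \<in> borel_measurable lebesgue \<and> integrable lebesgue (\<lambda>x. norm (f x) powr p)"

definition Lp_norm :: "real \<Rightarrow> (real \<Rightarrow> complex) \<Rightarrow> real" where
  "Lp_norm p f = (LINT x|lebesgue. norm (f x) powr p) powr (1 / p)"

definition hf_integrand ::
  "(real \<Rightarrow> complex) \<Rightarrow> (real \<Rightarrow> complex) \<Rightarrow> real \<Rightarrow> real \<Rightarrow> complex" where
  "hf_integrand f g x y =
     g y * (f (x + y) + f (x - y) + \<i> * f (- x - y) - \<i> * f (- x + y))"

(* At points x where the integrand is not Lebesgue integrable in y the value is the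
   library's default 0, so integrability has to be asserted separately. *)
definition hf_conv ::
  "(real \<Rightarrow> complex) \<Rightarrow> (real \<Rightarrow> complex) \<Rightarrow> real \<Rightarrow> complex" where
  "hf_conv f g x =
     complex_of_real (1 / (2 * sqrt (2 * pi))) * (LINT y|lebesgue. hf_integrand f g x y)"

end

theory Submission
  imports Defs
begin

text \<open>
  Expanding the kernel of the convolution, the trilinear integral
  \<open>\<integral> (f * g)(x) h(x) dx\<close> is bounded by \<open>1 / (2 sqrt (2 \<pi>))\<close> times the sum of four integrals of
  the form \<open>\<integral>\<integral> |g(y)| |f(a x + b y)| |h(x)| dy dx\<close> with \<open>a\<close> and \<open>b\<close> equal to \<open>1\<close> or \<open>-1\<close>.
  Each of them is at most the product of the three norms by Young's inequality in its trilinear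
  form with constant \<open>1\<close> (lemma \<open>young_trilinear\<close>), and \<open>4 / (2 sqrt (2 \<pi>)) = sqrt (2 / \<pi>)\<close>.

  Young's inequality is usually derived from Hoelder's inequality for three functions. By homogeneity
  it is enough to treat functions of norm at most one, and there the weighted inequality
  between arithmetic and geometric means, applied pointwise, suffices: it replaces the product
  \<open>u v w\<close> by a convex combination of products of only two of the powers \<open>u\<^sup>p\<close>, \<open>v\<^sup>q\<close>, \<open>w\<^sup>r\<close>
  (lemma \<open>triple_product_le_powr_pairs\<close>). By Tonelli's theorem and the invariance of Lebesgue measure
  under translation and reflection, each of these products has a double integral that factorises
  into two integrals bounded by one.

  The bound on the double integral of the absolute value makes Fubini's theorem applicable, which yields
  integrability in \<open>x\<close>. Taking the indicator function of a bounded interval for \<open>h\<close> shows that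
  the integrand of the convolution is integrable in \<open>y\<close> for almost every \<open>x\<close>.

  Tonelli's theorem needs \<open>f(x - y)\<close> to be measurable on a product of sigma-algebras, which can fail for
  a function that is merely Lebesgue measurable. All double integrals are therefore formed with Borel
  measurable functions equal almost everywhere to \<open>f\<close>, \<open>g\<close> and \<open>h\<close>. Since affine maps of the line
  preserve null sets, this replacement leaves the convolution unchanged at every point \<open>x\<close>.
\<close>

section \<open>A convexity bound for products\<close>

lemma powr_weighted_AM_GM3:
  fixes a b c \<alpha> \<beta> \<gamma> :: real
  assumes nonneg: "0 \<le> a" "0 \<le> b" "0 \<le> c"
    and pos: "0 < \<alpha>" "0 < \<beta>" "0 < \<gamma>" and sum1: "\<alpha> + \<beta> + \<gamma> = 1"
  shows "a powr \<alpha> * b powr \<beta> * c powr \<gamma> \<le> \<alpha> * a + \<beta> * b + \<gamma> * c"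
proof (cases "a = 0 \<or> b = 0 \<or> c = 0")
  case True
  then show ?thesis using nonneg pos by (auto intro!: add_nonneg_nonneg mult_nonneg_nonneg)
next
  case False
  then have gt: "0 < a" "0 < b" "0 < c" using nonneg by auto
  \<comment> \<open>The three-term mean is a two-term mean of \<open>c\<close> with the renormalised mean of \<open>a\<close> and \<open>b\<close>.\<close>
  define s where "s = \<alpha> + \<beta>"
  define d where "d = a powr (\<alpha> / s) * b powr (\<beta> / s)"
  have s: "0 < s" "s + \<gamma> = 1" using pos sum1 by (auto simp: s_def)
  have d0: "0 < d" using gt by (simp add: d_def)
  have d_le: "d \<le> (\<alpha> / s) * a + (\<beta> / s) * b"
    unfolding d_def by (rule Youngs_inequality_0)
      (use gt pos s in \<open>auto simp: s_def add_divide_distrib[symmetric]\<close>)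
  have "a powr \<alpha> * b powr \<beta> * c powr \<gamma> = d powr s * c powr \<gamma>"
    using s nonneg by (simp add: d_def powr_mult powr_powr)
  also have "\<dots> \<le> s * d + \<gamma> * c"
    by (rule Youngs_inequality_0) (use gt pos s d0 in auto)
  also have "s * d \<le> s * ((\<alpha> / s) * a + (\<beta> / s) * b)"
    using d_le s by (intro mult_left_mono) auto
  also have "s * ((\<alpha> / s) * a + (\<beta> / s) * b) = \<alpha> * a + \<beta> * b"
    using s by (simp add: field_simps)
  finally show ?thesis by simp
qed

text \<open>
  The three coefficients are the reciprocals of the exponents conjugate to \<open>r\<close>, \<open>p\<close> and \<open>q\<close>; they add up to
  one because the reciprocals of \<open>p\<close>, \<open>q\<close> and \<open>r\<close> add up to two. Raising the three products of pairs
  to these coefficients and multiplying, \<open>u\<close> receives the total exponent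
  \<open>p ((1 - 1/r) + (1 - 1/q)) = p (1/p) = 1\<close>, and similarly for \<open>v\<close> and \<open>w\<close>, so the left-hand side is
  the weighted geometric mean of the products on the right.
\<close>
lemma triple_product_le_powr_pairs:
  fixes u v w p q r :: real
  assumes pqr: "1 < p" "1 < q" "1 < r" "1 / p + 1 / q + 1 / r = 2"
    and nonneg: "0 \<le> u" "0 \<le> v" "0 \<le> w"
  shows "u * v * w \<le> (1 - 1 / r) * (u powr p * v powr q)
     + (1 - 1 / p) * (v powr q * w powr r) + (1 - 1 / q) * (u powr p * w powr r)"
proof -
  have split: "t powr (s * a) * t powr (s * b) = t"
    if "0 \<le> t" "1 < s" "a + b = 1 / s" for t s a b :: real
  proof -
    have "t powr (s * a) * t powr (s * b) = t powr (s * (a + b))"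
      by (simp add: powr_add distrib_left)
    also have "\<dots> = t" using that by simp
    finally show ?thesis .
  qed
  have "u * v * w = (u powr (p * (1 - 1 / r)) * u powr (p * (1 - 1 / q)))
      * (v powr (q * (1 - 1 / r)) * v powr (q * (1 - 1 / p)))
      * (w powr (r * (1 - 1 / p)) * w powr (r * (1 - 1 / q)))"
    using pqr nonneg by (simp add: split)
  also have "\<dots> = (u powr p * v powr q) powr (1 - 1 / r) * (v powr q * w powr r) powr (1 - 1 / p)
      * (u powr p * w powr r) powr (1 - 1 / q)"
    using nonneg by (simp only: powr_mult powr_powr mult_ac powr_ge_zero)
  also have "\<dots> \<le> (1 - 1 / r) * (u powr p * v powr q)
     + (1 - 1 / p) * (v powr q * w powr r) + (1 - 1 / q) * (u powr p * w powr r)"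
    by (rule powr_weighted_AM_GM3) (use pqr in auto)
  finally show ?thesis .
qed

section \<open>Young's inequality in trilinear form\<close>

lemma nn_integral_lborel_isometry:
  fixes f :: "real \<Rightarrow> ennreal"
  assumes "f \<in> borel_measurable borel" "\<bar>c\<bar> = 1"
  shows "(\<integral>\<^sup>+x. f (t + c * x) \<partial>lborel) = (\<integral>\<^sup>+x. f x \<partial>lborel)"
  using nn_integral_real_affine[of f c t] assms by auto

lemma nn_integral_lborel_twice_cmult:
  assumes [measurable]: "(\<lambda>(x, y). k x y) \<in> borel_measurable (borel \<Otimes>\<^sub>M borel)"
  shows "(\<integral>\<^sup>+x. \<integral>\<^sup>+y. c * k x y \<partial>lborel \<partial>lborel) = c * (\<integral>\<^sup>+x. \<integral>\<^sup>+y. k x y \<partial>lborel \<partial>lborel)"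
  by (simp add: nn_integral_cmult)

lemma nn_integral_lborel_twice_add:
  assumes [measurable]: "(\<lambda>(x, y). k x y) \<in> borel_measurable (borel \<Otimes>\<^sub>M borel)"
    "(\<lambda>(x, y). l x y) \<in> borel_measurable (borel \<Otimes>\<^sub>M borel)"
  shows "(\<integral>\<^sup>+x. \<integral>\<^sup>+y. k x y + l x y \<partial>lborel \<partial>lborel)
    = (\<integral>\<^sup>+x. \<integral>\<^sup>+y. k x y \<partial>lborel \<partial>lborel) + (\<integral>\<^sup>+x. \<integral>\<^sup>+y. l x y \<partial>lborel \<partial>lborel)"
  by (simp add: nn_integral_add)

text \<open>
  Each pair of the functions \<open>G(y)\<close>, \<open>F(a x + b y)\<close>, \<open>H(x)\<close> consists of functions of two independent
  affine coordinates of the plane. For each pair, integrating first in the variable that occurs in only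
  one of the two factors therefore separates them. Only the pair \<open>G(y)\<close>, \<open>F(a x + b y)\<close> requires the order of
  integration to be exchanged.
\<close>
lemma young_trilinear_normalized:
  fixes G F H :: "real \<Rightarrow> real" and p q r a b :: real
  assumes pqr: "1 < p" "1 < q" "1 < r" "1 / p + 1 / q + 1 / r = 2"
    and [measurable]: "G \<in> borel_measurable borel" "F \<in> borel_measurable borel"
      "H \<in> borel_measurable borel"
    and nonneg: "\<And>x. 0 \<le> G x" "\<And>x. 0 \<le> F x" "\<And>x. 0 \<le> H x"
    and ab: "\<bar>a\<bar> = 1" "\<bar>b\<bar> = 1"
    and norm: "(\<integral>\<^sup>+x. ennreal (G x powr p) \<partial>lborel) \<le> 1"
      "(\<integral>\<^sup>+x. ennreal (F x powr q) \<partial>lborel) \<le> 1"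
      "(\<integral>\<^sup>+x. ennreal (H x powr r) \<partial>lborel) \<le> 1"
  shows "(\<integral>\<^sup>+x. \<integral>\<^sup>+y. ennreal (G y * F (a * x + b * y) * H x) \<partial>lborel \<partial>lborel) \<le> 1"
proof -
  define g where "g = (\<lambda>x. ennreal (G x powr p))"
  define f where "f = (\<lambda>x. ennreal (F x powr q))"
  define h where "h = (\<lambda>x. ennreal (H x powr r))"
  define \<alpha> where "\<alpha> = 1 - 1 / r"
  define \<beta> where "\<beta> = 1 - 1 / p"
  define \<gamma> where "\<gamma> = 1 - 1 / q"
  have pos: "0 < \<alpha>" "0 < \<beta>" "0 < \<gamma>" "\<alpha> + \<beta> + \<gamma> = 1"
    using pqr by (auto simp: \<alpha>_def \<beta>_def \<gamma>_def)
  have [measurable]: "g \<in> borel_measurable borel" "f \<in> borel_measurable borel"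
      "h \<in> borel_measurable borel"
    unfolding g_def f_def h_def by measurable
  have norm': "integral\<^sup>N lborel g \<le> 1" "integral\<^sup>N lborel f \<le> 1" "integral\<^sup>N lborel h \<le> 1"
    using norm by (simp_all add: g_def f_def h_def)
  have shift_y: "(\<integral>\<^sup>+y. f (a * x + b * y) \<partial>lborel) = integral\<^sup>N lborel f" for x
    using nn_integral_lborel_isometry[of f b "a * x"] ab by simp
  have shift_x: "(\<integral>\<^sup>+x. f (a * x + b * y) \<partial>lborel) = integral\<^sup>N lborel f" for y
    using nn_integral_lborel_isometry[of f a "b * y"] ab by (simp add: add.commute)
  have gf: "(\<integral>\<^sup>+x. \<integral>\<^sup>+y. g y * f (a * x + b * y) \<partial>lborel \<partial>lborel) \<le> 1"
  proof -
    have "(\<integral>\<^sup>+x. \<integral>\<^sup>+y. g y * f (a * x + b * y) \<partial>lborel \<partial>lborel)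
        = (\<integral>\<^sup>+y. \<integral>\<^sup>+x. g y * f (a * x + b * y) \<partial>lborel \<partial>lborel)"
      by (rule lborel_pair.Fubini') measurable
    also have "\<dots> = integral\<^sup>N lborel g * integral\<^sup>N lborel f"
      by (simp add: nn_integral_cmult nn_integral_multc shift_x)
    also have "\<dots> \<le> 1 * 1" by (intro mult_mono norm') auto
    finally show ?thesis by simp
  qed
  have fh: "(\<integral>\<^sup>+x. \<integral>\<^sup>+y. f (a * x + b * y) * h x \<partial>lborel \<partial>lborel) \<le> 1"
  proof -
    have "(\<integral>\<^sup>+x. \<integral>\<^sup>+y. f (a * x + b * y) * h x \<partial>lborel \<partial>lborel)
        = integral\<^sup>N lborel f * integral\<^sup>N lborel h"
      by (simp add: nn_integral_cmult nn_integral_multc shift_y)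
    also have "\<dots> \<le> 1 * 1" by (intro mult_mono norm') auto
    finally show ?thesis by simp
  qed
  have gh: "(\<integral>\<^sup>+x. \<integral>\<^sup>+y. g y * h x \<partial>lborel \<partial>lborel) \<le> 1"
  proof -
    have "(\<integral>\<^sup>+x. \<integral>\<^sup>+y. g y * h x \<partial>lborel \<partial>lborel)
        = integral\<^sup>N lborel g * integral\<^sup>N lborel h"
      by (simp add: nn_integral_cmult nn_integral_multc)
    also have "\<dots> \<le> 1 * 1" by (intro mult_mono norm') auto
    finally show ?thesis by simp
  qed
  have pw: "ennreal (G y * F (a * x + b * y) * H x) \<le> ennreal \<alpha> * (g y * f (a * x + b * y))
      + ennreal \<beta> * (f (a * x + b * y) * h x) + ennreal \<gamma> * (g y * h x)" for x y
  proof -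
    have "ennreal (G y * F (a * x + b * y) * H x)
       \<le> ennreal (\<alpha> * (G y powr p * F (a * x + b * y) powr q)
          + \<beta> * (F (a * x + b * y) powr q * H x powr r) + \<gamma> * (G y powr p * H x powr r))"
      unfolding \<alpha>_def \<beta>_def \<gamma>_def
      by (intro ennreal_leI triple_product_le_powr_pairs pqr nonneg)
    then show ?thesis
      using pos by (simp add: g_def f_def h_def ennreal_mult ennreal_plus)
  qed
  have "(\<integral>\<^sup>+x. \<integral>\<^sup>+y. ennreal (G y * F (a * x + b * y) * H x) \<partial>lborel \<partial>lborel)
     \<le> (\<integral>\<^sup>+x. \<integral>\<^sup>+y. (ennreal \<alpha> * (g y * f (a * x + b * y))
      + ennreal \<beta> * (f (a * x + b * y) * h x) + ennreal \<gamma> * (g y * h x)) \<partial>lborel \<partial>lborel)"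
    by (intro nn_integral_mono pw)
  also have "\<dots> = ennreal \<alpha> * (\<integral>\<^sup>+x. \<integral>\<^sup>+y. g y * f (a * x + b * y) \<partial>lborel \<partial>lborel)
      + ennreal \<beta> * (\<integral>\<^sup>+x. \<integral>\<^sup>+y. f (a * x + b * y) * h x \<partial>lborel \<partial>lborel)
      + ennreal \<gamma> * (\<integral>\<^sup>+x. \<integral>\<^sup>+y. g y * h x \<partial>lborel \<partial>lborel)"
    by (simp add: nn_integral_lborel_twice_add nn_integral_lborel_twice_cmult)
  also have "\<dots> \<le> ennreal \<alpha> * 1 + ennreal \<beta> * 1 + ennreal \<gamma> * 1"
    by (intro add_mono mult_left_mono gf fh gh) auto
  also have "\<dots> = 1"
    using pos by (simp flip: ennreal_plus)
  finally show ?thesis .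
qed

text \<open>
  Dividing by the norms reduces this to the normalised case. To avoid a separate treatment of functions
  with norm zero, the functions are divided by slightly larger positive numbers, the norms plus \<open>e\<close>, and
  then \<open>e\<close> tends to zero.
\<close>
lemma young_trilinear:
  fixes G F H :: "real \<Rightarrow> real" and p q r a b :: real
  assumes pqr: "1 < p" "1 < q" "1 < r" "1 / p + 1 / q + 1 / r = 2"
    and [measurable]: "G \<in> borel_measurable borel" "F \<in> borel_measurable borel"
      "H \<in> borel_measurable borel"
    and nonneg: "\<And>x. 0 \<le> G x" "\<And>x. 0 \<le> F x" "\<And>x. 0 \<le> H x"
    and ab: "\<bar>a\<bar> = 1" "\<bar>b\<bar> = 1"
    and int: "integrable lborel (\<lambda>x. G x powr p)" "integrable lborel (\<lambda>x. F x powr q)"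
      "integrable lborel (\<lambda>x. H x powr r)"
  shows "(\<integral>\<^sup>+x. \<integral>\<^sup>+y. ennreal (G y * F (a * x + b * y) * H x) \<partial>lborel \<partial>lborel)
    \<le> ennreal ((LINT x|lborel. G x powr p) powr (1 / p)
        * (LINT x|lborel. F x powr q) powr (1 / q) * (LINT x|lborel. H x powr r) powr (1 / r))"
    (is "?I \<le> ennreal (?A * ?B * ?C)")
proof -
  have normalize: "(\<integral>\<^sup>+x. ennreal ((u x / A) powr s) \<partial>lborel) \<le> 1"
    if u: "integrable lborel (\<lambda>x. u x powr s)" "\<And>x. 0 \<le> u x" and s: "1 < s"
      and A: "(LINT x|lborel. u x powr s) powr (1 / s) < A" for u :: "real \<Rightarrow> real" and s A
  proof -
    have A0: "0 < A" using A by (rule le_less_trans[rotated]) simp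
    have I0: "0 \<le> (LINT x|lborel. u x powr s)" by simp
    have "(LINT x|lborel. u x powr s) = ((LINT x|lborel. u x powr s) powr (1 / s)) powr s"
      using s I0 by (simp add: powr_powr)
    also have "\<dots> \<le> A powr s"
      using A s by (intro powr_mono2) auto
    finally have le: "(LINT x|lborel. u x powr s) / A powr s \<le> 1"
      using A0 by (simp add: field_simps)
    have "(\<integral>\<^sup>+x. ennreal ((u x / A) powr s) \<partial>lborel)
        = (\<integral>\<^sup>+x. ennreal (u x powr s / A powr s) \<partial>lborel)"
      using u A0 by (simp add: powr_divide)
    also have "\<dots> = ennreal (LINT x|lborel. u x powr s / A powr s)"
      using u by (intro nn_integral_eq_integral) auto
    also have "\<dots> \<le> 1" using le by simp
    finally show ?thesis .
  qed
  have rescale: "ennreal (u * v * w) = ennreal (A * B * C) * ennreal (u / A * (v / B) * (w / C))"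
    if "0 < A" "0 < B" "0 < C" "0 \<le> u" "0 \<le> v" "0 \<le> w" for A B C u v w :: real
    using that by (simp add: field_simps flip: ennreal_mult)
  have approx: "?I \<le> ennreal ((?A + e) * (?B + e) * (?C + e))" if e: "0 < e" for e :: real
  proof -
    let ?a = "?A + e" and ?b = "?B + e" and ?c = "?C + e"
    have pos: "0 < ?a" "0 < ?b" "0 < ?c"
      using e by (auto intro: add_nonneg_pos)
    have "?I = (\<integral>\<^sup>+x. \<integral>\<^sup>+y. ennreal (?a * ?b * ?c) *
        ennreal (G y / ?a * (F (a * x + b * y) / ?b) * (H x / ?c)) \<partial>lborel \<partial>lborel)"
      by (intro nn_integral_cong rescale pos nonneg)
    also have "\<dots> = ennreal (?a * ?b * ?c) * (\<integral>\<^sup>+x. \<integral>\<^sup>+y.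
        ennreal (G y / ?a * (F (a * x + b * y) / ?b) * (H x / ?c)) \<partial>lborel \<partial>lborel)"
      by (rule nn_integral_lborel_twice_cmult) measurable
    also have "\<dots> \<le> ennreal (?a * ?b * ?c) * 1"
      by (intro mult_left_mono young_trilinear_normalized[OF pqr, where a=a and b=b])
        (use nonneg pos ab int pqr e in \<open>auto intro!: normalize divide_nonneg_pos\<close>)
    finally show ?thesis by simp
  qed
  have "((\<lambda>e. ennreal ((?A + e) * (?B + e) * (?C + e)))
      \<longlongrightarrow> ennreal ((?A + 0) * (?B + 0) * (?C + 0))) (at_right 0)"
    by (intro tendsto_ennrealI tendsto_intros)
  moreover have "\<forall>\<^sub>F e in at_right 0. ?I \<le> ennreal ((?A + e) * (?B + e) * (?C + e))"
    by (rule eventually_mono[OF eventually_at_right_less approx])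
  ultimately have "?I \<le> ennreal ((?A + 0) * (?B + 0) * (?C + 0))"
    by (rule tendsto_lowerbound) simp
  then show ?thesis by simp
qed

section \<open>The Hartley-Fourier kernel for Borel functions\<close>

lemma Lp_norm_borel:
  assumes "f \<in> borel_measurable borel" "in_Lp p f"
  shows "integrable lborel (\<lambda>x. norm (f x) powr p)"
    and "(LINT x|lborel. norm (f x) powr p) powr (1 / p) = Lp_norm p f"
proof -
  have "(\<lambda>x. norm (f x) powr p) \<in> borel_measurable lborel"
    using assms(1) by measurable
  then show "integrable lborel (\<lambda>x. norm (f x) powr p)"
    and "(LINT x|lborel. norm (f x) powr p) powr (1 / p) = Lp_norm p f"
    using assms(2) by (simp_all add: in_Lp_def Lp_norm_def integrable_completion integral_completion)
qed

lemma hf_integrand_measurable [measurable]: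
  assumes [measurable]: "f \<in> borel_measurable borel" "g \<in> borel_measurable borel"
  shows "(\<lambda>(x, y). hf_integrand f g x y) \<in> borel_measurable (borel \<Otimes>\<^sub>M borel)"
  unfolding hf_integrand_def by measurable

text \<open>
  The arguments of \<open>f\<close> are written with explicit coefficients \<open>1\<close> and \<open>-1\<close> so that the four summands
  are instances of one expression in \<open>a x + b y\<close>, the form in which Young's inequality applies.
\<close>
lemma norm_hf_integrand_le:
  "norm (hf_integrand f g x y) \<le> norm (g y) * norm (f (1 * x + 1 * y))
    + norm (g y) * norm (f (1 * x + (-1) * y)) + norm (g y) * norm (f ((-1) * x + (-1) * y))
    + norm (g y) * norm (f ((-1) * x + 1 * y))"
proof -
  have "norm (f (x + y) + f (x - y) + \<i> * f (- x - y) - \<i> * f (- x + y))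
     \<le> norm (f (x + y)) + norm (f (x - y)) + norm (\<i> * f (- x - y)) + norm (\<i> * f (- x + y))"
    by (intro order_trans[OF norm_triangle_ineq4] add_mono order_trans[OF norm_triangle_ineq]) auto
  then have "norm (g y) * norm (f (x + y) + f (x - y) + \<i> * f (- x - y) - \<i> * f (- x + y))
    \<le> norm (g y) * (norm (f (x + y)) + norm (f (x - y)) + norm (f (- x - y)) + norm (f (- x + y)))"
    by (intro mult_left_mono) (auto simp: norm_mult)
  then show ?thesis
    by (simp add: hf_integrand_def norm_mult distrib_left)
qed

lemma hf_trilinear_bound:
  fixes f g h :: "real \<Rightarrow> complex"
  assumes pqr: "1 < p" "1 < q" "1 < r" "1 / p + 1 / q + 1 / r = 2"
    and [measurable]: "g \<in> borel_measurable borel" "f \<in> borel_measurable borel"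
      "h \<in> borel_measurable borel"
    and Lp: "in_Lp p g" "in_Lp q f" "in_Lp r h"
  shows "(\<integral>\<^sup>+x. \<integral>\<^sup>+y. ennreal (norm (hf_integrand f g x y * h x)) \<partial>lborel \<partial>lborel)
    \<le> ennreal (4 * (Lp_norm p g * Lp_norm q f * Lp_norm r h))"
proof -
  let ?N = "Lp_norm p g * Lp_norm q f * Lp_norm r h"
  define k where "k a b x y = ennreal (norm (g y) * norm (f (a * x + b * y)) * norm (h x))" for a b x y
  have [measurable]: "(\<lambda>(x, y). k a b x y) \<in> borel_measurable (borel \<Otimes>\<^sub>M borel)" for a b
    unfolding k_def by measurable
  have k_le: "(\<integral>\<^sup>+x. \<integral>\<^sup>+y. k a b x y \<partial>lborel \<partial>lborel) \<le> ennreal ?N"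
    if "\<bar>a\<bar> = 1" "\<bar>b\<bar> = 1" for a b
    using young_trilinear[OF pqr, of "\<lambda>x. norm (g x)" "\<lambda>x. norm (f x)" "\<lambda>x. norm (h x)" a b] that
    by (simp add: k_def Lp_norm_borel Lp)
  have "(\<integral>\<^sup>+x. \<integral>\<^sup>+y. ennreal (norm (hf_integrand f g x y * h x)) \<partial>lborel \<partial>lborel)
    \<le> (\<integral>\<^sup>+x. \<integral>\<^sup>+y. (k 1 1 x y + k 1 (-1) x y + k (-1) (-1) x y + k (-1) 1 x y) \<partial>lborel \<partial>lborel)"
  proof (intro nn_integral_mono)
    fix x y
    have "norm (hf_integrand f g x y * h x) \<le> (norm (g y) * norm (f (1 * x + 1 * y))
    + norm (g y) * norm (f (1 * x + (-1) * y)) + norm (g y) * norm (f ((-1) * x + (-1) * y))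
    + norm (g y) * norm (f ((-1) * x + 1 * y))) * norm (h x)"
      unfolding norm_mult[of _ "h x"] by (intro mult_right_mono norm_hf_integrand_le) auto
    then show "ennreal (norm (hf_integrand f g x y * h x))
      \<le> k 1 1 x y + k 1 (-1) x y + k (-1) (-1) x y + k (-1) 1 x y"
      unfolding k_def by (simp flip: ennreal_plus add: distrib_right)
  qed
  also have "\<dots> = (\<integral>\<^sup>+x. \<integral>\<^sup>+y. k 1 1 x y \<partial>lborel \<partial>lborel) + (\<integral>\<^sup>+x. \<integral>\<^sup>+y. k 1 (-1) x y \<partial>lborel \<partial>lborel)
     + (\<integral>\<^sup>+x. \<integral>\<^sup>+y. k (-1) (-1) x y \<partial>lborel \<partial>lborel) + (\<integral>\<^sup>+x. \<integral>\<^sup>+y. k (-1) 1 x y \<partial>lborel \<partial>lborel)"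
    by (simp add: nn_integral_lborel_twice_add)
  also have "\<dots> \<le> ennreal ?N + ennreal ?N + ennreal ?N + ennreal ?N"
    by (intro add_mono k_le) auto
  also have "\<dots> = ennreal (4 * ?N)"
    by (simp flip: ennreal_plus add: Lp_norm_def)
  finally show ?thesis .
qed

lemma in_Lp_indicator_interval:
  "in_Lp r (indicator {a..b})"
proof -
  have "(\<lambda>x. norm (indicator {a..b} x :: complex) powr r) = (indicator {a..b} :: real \<Rightarrow> real)"
    by (auto simp: indicator_def)
  moreover have "integrable lebesgue (indicator {a..b} :: real \<Rightarrow> real)"
    by (rule integrable_real_indicator) (auto simp: emeasure_lborel_Icc_eq)
  moreover have "(indicator {a..b} :: real \<Rightarrow> complex) \<in> borel_measurable lebesgue"
    by (rule borel_measurable_indicator) auto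
  ultimately show ?thesis
    by (simp add: in_Lp_def)
qed

text \<open>
  Finiteness of the trilinear integral with \<open>h\<close> the indicator of \<open>[-n, n]\<close> forces the inner integral to be
  finite for almost every \<open>x\<close> in that interval, and countably many such intervals cover the line.
\<close>
lemma AE_integrable_hf_integrand_borel:
  assumes pqr: "1 < p" "1 < q" "1 < r" "1 / p + 1 / q + 1 / r = 2"
    and [measurable]: "g \<in> borel_measurable borel" "f \<in> borel_measurable borel"
    and Lp: "in_Lp p g" "in_Lp q f"
  shows "AE x in lborel. integrable lborel (hf_integrand f g x)"
proof -
  have "AE x in lborel. x \<in> {- real n..real n} \<longrightarrow> integrable lborel (hf_integrand f g x)" for n
  proof -
    let ?h = "indicator {- real n..real n} :: real \<Rightarrow> complex"
    let ?K = "\<lambda>x. \<integral>\<^sup>+y. ennreal (norm (hf_integrand f g x y * ?h x)) \<partial>lborel"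
    have "integral\<^sup>N lborel ?K < \<infinity>"
      by (rule le_less_trans[OF hf_trilinear_bound[OF pqr _ _ _ Lp in_Lp_indicator_interval]]) auto
    then have "AE x in lborel. ?K x \<noteq> \<infinity>"
      by (intro nn_integral_PInf_AE) auto
    then show ?thesis
      by eventually_elim (auto simp: integrable_iff_bounded top.not_eq_extremum)
  qed
  then have "AE x in lborel. \<forall>n. x \<in> {- real n..real n} \<longrightarrow> integrable lborel (hf_integrand f g x)"
    unfolding AE_all_countable by blast
  then show ?thesis
  proof eventually_elim
    case (elim x)
    obtain n where "\<bar>x\<bar> \<le> real n" using real_arch_simple by blast
    then show ?case using elim by (auto simp: abs_le_iff)
  qed
qed

section \<open>Passage from Lebesgue to Borel measurable functions\<close>

lemma in_Lp_borel_representative: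
  assumes "in_Lp p f"
  obtains f' where "f' \<in> borel_measurable borel" "in_Lp p f'" "Lp_norm p f' = Lp_norm p f"
    "AE x in lborel. f x = f' x"
proof -
  have meas: "f \<in> borel_measurable lebesgue"
    using assms by (simp add: in_Lp_def)
  obtain u where u: "u \<in> borel_measurable lborel" "AE x in lborel. Re (f x) = u x"
    using completion_ex_borel_measurable_real[of "\<lambda>x. Re (f x)" lborel] meas by auto
  obtain v where v: "v \<in> borel_measurable lborel" "AE x in lborel. Im (f x) = v x"
    using completion_ex_borel_measurable_real[of "\<lambda>x. Im (f x)" lborel] meas by auto
  define f' where "f' x = complex_of_real (u x) + \<i> * complex_of_real (v x)" for x
  have f'[measurable]: "f' \<in> borel_measurable borel"
    using u(1) v(1) unfolding f'_def by simp
  have ae: "AE x in lborel. f x = f' x"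
    using u(2) v(2) by eventually_elim (simp add: f'_def complex_eq_iff)
  have f'L: "f' \<in> borel_measurable lebesgue"
    by (rule measurable_completion) simp
  have ae': "AE x in lebesgue. norm (f x) powr p = norm (f' x) powr p"
    by (rule AE_completion) (use ae in \<open>eventually_elim, simp\<close>)
  have "integrable lebesgue (\<lambda>x. norm (f' x) powr p)"
    using assms f'L ae' by (subst integrable_cong_AE[symmetric]) (auto simp: in_Lp_def)
  then have "in_Lp p f'" using f'L by (simp add: in_Lp_def)
  moreover have "(LINT x|lebesgue. norm (f' x) powr p) = (LINT x|lebesgue. norm (f x) powr p)"
    using meas f'L ae' by (intro integral_cong_AE[symmetric]) auto
  then have "Lp_norm p f' = Lp_norm p f" by (simp add: Lp_norm_def)
  ultimately show thesis using f' ae that by blast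
qed

text \<open>
  The predicate is arbitrary because it will express equality of a Lebesgue measurable function with its
  Borel representative, which need not define a Borel set. Enlarging the exceptional set to a Borel null
  set reduces this to \<open>AE_borel_affine\<close>.
\<close>
lemma AE_lborel_affine:
  fixes P :: "real \<Rightarrow> bool"
  assumes "AE x in lborel. P x" "c \<noteq> 0"
  shows "AE x in lborel. P (t + c * x)"
proof -
  obtain N where N: "N \<in> null_sets lborel" "{x. \<not> P x} \<subseteq> N"
    using assms(1) by (auto elim!: AE_E simp: null_sets_def)
  have "AE x in lborel. t + c * x \<notin> N"
    by (rule AE_borel_affine) (use N assms AE_not_in[OF N(1)] in auto)
  then show ?thesis
    by eventually_elim (use N in auto)
qed

lemma AE_hf_integrand_cong:
  assumes "AE y in lborel. f y = f' y" "AE y in lborel. g y = g' y"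
  shows "AE y in lborel. hf_integrand f g x y = hf_integrand f' g' x y"
proof -
  have plus: "AE y in lborel. f (t + y) = f' (t + y)" for t
    using AE_lborel_affine[OF assms(1), where c = 1 and t = t] by simp
  have minus: "AE y in lborel. f (t - y) = f' (t - y)" for t
    using AE_lborel_affine[OF assms(1), where c = "-1" and t = t] by simp
  show ?thesis
    using assms(2) plus[of x] minus[of x] plus[of "- x"] minus[of "- x"]
    by eventually_elim (simp add: hf_integrand_def)
qed

lemma hf_integrand_lebesgue_measurable:
  assumes "f \<in> borel_measurable lebesgue" and [measurable]: "g \<in> borel_measurable lebesgue"
  shows "hf_integrand f g x \<in> borel_measurable lebesgue"
proof -
  have aff: "(\<lambda>y. f (t + c * y)) \<in> borel_measurable lebesgue" if "c \<noteq> 0" for t c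
    using measurable_compose[OF lebesgue_affine_measurable[where c = "\<lambda>_::real. c" and t = t] assms(1)] that
    by simp
  have [measurable]: "(\<lambda>y. f (t + y)) \<in> borel_measurable lebesgue"
      "(\<lambda>y. f (t - y)) \<in> borel_measurable lebesgue" for t
    using aff[of 1 t] aff[of "-1" t] by simp_all
  show ?thesis unfolding hf_integrand_def by measurable
qed

section \<open>The trilinear estimate for the convolution\<close>

theorem theorem3p1:
  fixes p q r :: real and f g h :: "real \<Rightarrow> complex"
  assumes "1 < p" and "1 < q" and "1 < r"
    and "1 / p + 1 / q + 1 / r = 2"
    and "in_Lp p g" and "in_Lp q f" and "in_Lp r h"
  shows "(AE x in lebesgue. integrable lebesgue (hf_integrand f g x)) \<and>
         integrable lebesgue (\<lambda>x. hf_conv f g x * h x) \<and>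
         norm (LINT x|lebesgue. hf_conv f g x * h x)
           \<le> sqrt (2 / pi) * Lp_norm p g * Lp_norm q f * Lp_norm r h"
proof -
  note pqr = assms(1-4)
  obtain g' where g'[measurable]: "g' \<in> borel_measurable borel"
    and g'_Lp: "in_Lp p g'" "Lp_norm p g' = Lp_norm p g" and g_eq: "AE x in lborel. g x = g' x"
    using in_Lp_borel_representative[OF assms(5)] .
  obtain f' where f'[measurable]: "f' \<in> borel_measurable borel"
    and f'_Lp: "in_Lp q f'" "Lp_norm q f' = Lp_norm q f" and f_eq: "AE x in lborel. f x = f' x"
    using in_Lp_borel_representative[OF assms(6)] .
  obtain h' where h'[measurable]: "h' \<in> borel_measurable borel"
    and h'_Lp: "in_Lp r h'" "Lp_norm r h' = Lp_norm r h" and h_eq: "AE x in lborel. h x = h' x"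
    using in_Lp_borel_representative[OF assms(7)] .
  let ?N = "Lp_norm p g * Lp_norm q f * Lp_norm r h"
  let ?c = "1 / (2 * sqrt (2 * pi))"
  define K where "K = (\<lambda>(x, y). hf_integrand f' g' x y * h' x)"
  define \<Phi> where "\<Phi> x = (LINT y|lborel. K (x, y))" for x

  have f_meas: "f \<in> borel_measurable lebesgue" and g_meas: "g \<in> borel_measurable lebesgue"
    and h_meas: "h \<in> borel_measurable lebesgue"
    using assms by (auto simp: in_Lp_def)
  have slice[measurable]: "hf_integrand f' g' x \<in> borel_measurable borel" for x
    by measurable
  have slice': "hf_integrand f' g' x \<in> borel_measurable lebesgue" for x
    by (rule measurable_completion) simp
  have slice_eq: "AE y in lebesgue. hf_integrand f g x y = hf_integrand f' g' x y" for x
    by (intro AE_completion AE_hf_integrand_cong f_eq g_eq)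

  have "AE x in lborel. integrable lborel (hf_integrand f' g' x)"
    by (rule AE_integrable_hf_integrand_borel[OF pqr g' f' g'_Lp(1) f'_Lp(1)])
  moreover have "integrable lebesgue (hf_integrand f g x) \<longleftrightarrow> integrable lborel (hf_integrand f' g' x)" for x
    using integrable_cong_AE[OF hf_integrand_lebesgue_measurable[OF f_meas g_meas] slice' slice_eq]
    by (simp add: integrable_completion)
  ultimately have ae_integrable: "AE x in lebesgue. integrable lebesgue (hf_integrand f g x)"
    by (simp add: AE_completion)

  have conv_eq: "hf_conv f g x = complex_of_real ?c * (LINT y|lborel. hf_integrand f' g' x y)" for x
    using integral_cong_AE[OF hf_integrand_lebesgue_measurable[OF f_meas g_meas] slice' slice_eq]
    by (simp add: hf_conv_def integral_completion)

  have K_meas[measurable]: "K \<in> borel_measurable (lborel \<Otimes>\<^sub>M lborel)"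
    unfolding K_def by measurable
  have K_bound: "(\<integral>\<^sup>+z. ennreal (norm (K z)) \<partial>(lborel \<Otimes>\<^sub>M lborel)) \<le> ennreal (4 * ?N)"
    using hf_trilinear_bound[OF pqr g' f' h' g'_Lp(1) f'_Lp(1) h'_Lp(1)]
    by (subst lborel.nn_integral_fst[symmetric]) (simp_all add: K_def g'_Lp f'_Lp h'_Lp)
  have K_int: "integrable (lborel \<Otimes>\<^sub>M lborel) K"
    by (rule integrableI_bounded) (use K_bound in \<open>auto intro: le_less_trans\<close>)
  have \<Phi>_int: "integrable lborel \<Phi>"
    unfolding \<Phi>_def by (rule lborel_pair.integrable_fst'[OF K_int])
  have "integral\<^sup>L lborel \<Phi> = integral\<^sup>L (lborel \<Otimes>\<^sub>M lborel) K"
    unfolding \<Phi>_def by (rule lborel_pair.integral_fst'[OF K_int])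
  then have "ennreal (norm (integral\<^sup>L lborel \<Phi>)) \<le> ennreal (4 * ?N)"
    using integral_norm_bound_ennreal[OF K_int] K_bound by simp
  then have \<Phi>_le: "norm (integral\<^sup>L lborel \<Phi>) \<le> 4 * ?N"
    by (subst (asm) ennreal_le_iff) (auto simp: Lp_norm_def)

  have prod_eq: "AE x in lebesgue. hf_conv f g x * h x = complex_of_real ?c * \<Phi> x"
    by (rule AE_completion) (use h_eq in \<open>eventually_elim, simp add: conv_eq \<Phi>_def K_def\<close>)
  have \<Phi>_meas: "\<Phi> \<in> borel_measurable borel"
    using \<Phi>_int by auto
  have conv_meas: "hf_conv f g \<in> borel_measurable lebesgue"
    unfolding conv_eq[abs_def] by (intro measurable_completion) measurable
  have lhs_meas: "(\<lambda>x. hf_conv f g x * h x) \<in> borel_measurable lebesgue"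
    using conv_meas h_meas by measurable
  have rhs_meas: "(\<lambda>x. complex_of_real ?c * \<Phi> x) \<in> borel_measurable lborel"
    using \<Phi>_meas by measurable
  have "integrable lebesgue (\<lambda>x. complex_of_real ?c * \<Phi> x)"
    using \<Phi>_int by (subst integrable_completion[OF rhs_meas]) simp
  then have integrable: "integrable lebesgue (\<lambda>x. hf_conv f g x * h x)"
    using integrable_cong_AE[OF lhs_meas measurable_completion[OF rhs_meas] prod_eq] by blast

  have "(LINT x|lebesgue. hf_conv f g x * h x) = complex_of_real ?c * integral\<^sup>L lborel \<Phi>"
    using integral_cong_AE[OF lhs_meas measurable_completion[OF rhs_meas] prod_eq]
    using \<Phi>_meas by (simp add: integral_completion)
  then have "norm (LINT x|lebesgue. hf_conv f g x * h x) = ?c * norm (integral\<^sup>L lborel \<Phi>)"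
    by (simp add: norm_mult norm_divide)
  also have "\<dots> \<le> ?c * (4 * ?N)"
    using \<Phi>_le by (intro mult_left_mono) auto
  also have "\<dots> = sqrt (2 / pi) * ?N"
  proof -
    have "2 / (sqrt pi * sqrt 2) = sqrt 2 / sqrt pi"
      by (simp add: field_simps)
    then have "?c * 4 = sqrt (2 / pi)"
      by (simp add: real_sqrt_mult real_sqrt_divide)
    then show ?thesis by (simp only: mult.assoc[symmetric])
  qed
  finally show ?thesis
    using ae_integrable integrable by (simp add: mult.assoc)
qed

end
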